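(* Let $n \geq 3$. There exists a positive integral point $x = (x_1,\ldots,x_n; y_1,\ldots,y_n) \in Y_{B_n}(\mathbb{N})$ such that $$x_2 = F_{n+1} F_{n+2} - 1.$$ Moreover, $x_2$ is the largest coordinate of the point $x$ (among all the coordinates $x_1,\ldots,x_n,y_1,\ldots,y_n$).
   Context: $(F_k)_{k\ge 0}$ is the Fibonacci sequence: $F_0 = 0$, $F_1 = 1$, $F_{k+1} = F_k + F_{k-1}$. $\mathbb{N}$ denotes the set of positive integers. For $n \ge 3$, $Y_{B_n} \subset \mathbb{A}^{2n}$ is the affine variety in coordinates $(x_1,\ldots,x_n;y_1,\ldots,y_n)$ defined by the equations $$x_1 y_1 = x_2 + 1,$$ $$x_2 y_2 = x_1^2 + x_3,$$ $$x_i y_i = x_{i-1} + x_{i+1} \quad (3 \leq i \leq n-1),$$ $$x_n y_n = x_{n-1} + 1.$$ A positive integral point of $Y_{B_n}$, i.e. an element of $Y_{B_n}(\mathbb{N})$, is a solution in which every coordinate $x_i$ and $y_i$ is a positive integer. *)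

theory Defs
  imports "HOL-Number_Theory.Fib" "HOL-Library.FuncSet"
begin

(* A point of A^{2n} is a pair of functions on {1..n}, extensional so that
   equality of points is equality of their coordinates. *)
definition Y_B :: "nat \<Rightarrow> ((nat \<Rightarrow> 'a::comm_ring_1) \<times> (nat \<Rightarrow> 'a)) set" where
  "Y_B n = {(x, y). x \<in> {1..n} \<rightarrow>\<^sub>E UNIV \<and> y \<in> {1..n} \<rightarrow>\<^sub>E UNIV \<and>
     x 1 * y 1 = x 2 + 1 \<and>
     x 2 * y 2 = (x 1)\<^sup>2 + x 3 \<and>
     (\<forall>i\<in>{3..n - 1}. x i * y i = x (i - 1) + x (i + 1)) \<and>
     x n * y n = x (n - 1) + 1}"

definition Y_B_pos :: "nat \<Rightarrow> ((nat \<Rightarrow> int) \<times> (nat \<Rightarrow> int)) set" where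
  "Y_B_pos n = {(x, y) \<in> Y_B n. \<forall>i\<in>{1..n}. x i > 0 \<and> y i > 0}"

end

theory Submission
  imports Defs
begin

text \<open>
  The point is written down explicitly. Read from the end, the coordinates
  \<open>x\<^sub>n\<^sub>+\<^sub>1 = 1, x\<^sub>n, \<dots>, x\<^sub>2\<close> form a sequence \<open>z\<^sub>1, z\<^sub>2, \<dots>, z\<^sub>n\<close>, where \<open>x\<^sub>n\<^sub>+\<^sub>1 = 1\<close> is the
  constant in the last equation, and the equations with index at least 3 say that
  \<open>z\<^sub>j\<close> divides \<open>z\<^sub>j\<^sub>-\<^sub>1 + z\<^sub>j\<^sub>+\<^sub>1\<close>. The quotients are the coordinates \<open>y\<^sub>i\<close> with \<open>i \<ge> 3\<close>. With all
  quotients equal to 3 one gets the even-indexed Fibonacci numbers, which are too small;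
  raising a single quotient, the middle one at \<open>j = m = n div 2\<close>, from 3 to 5 gives
  \<open>z\<^sub>j = F\<^sub>2\<^sub>j\<close> up to \<open>m\<close> and adds \<open>2 F\<^sub>2\<^sub>m F\<^sub>2\<^sub>(\<^sub>j\<^sub>-\<^sub>m\<^sub>)\<close> beyond it.

  The choice of the middle is what makes the other two equations work. When \<open>a\<close> and \<open>b\<close>
  are equal or consecutive, the addition formula and Cassini's identity give
  \<open>F\<^sub>2\<^sub>(\<^sub>a\<^sub>+\<^sub>b\<^sub>) + 2 F\<^sub>2\<^sub>a F\<^sub>2\<^sub>b = F\<^sub>a\<^sub>+\<^sub>b\<^sub>+\<^sub>1 F\<^sub>a\<^sub>+\<^sub>b\<^sub>+\<^sub>2 - 1\<close>. This applies to both \<open>z\<^sub>n\<close> and \<open>z\<^sub>n\<^sub>-\<^sub>1\<close>, so that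
  \<open>x\<^sub>2 = F\<^sub>n\<^sub>+\<^sub>1 F\<^sub>n\<^sub>+\<^sub>2 - 1\<close> and \<open>x\<^sub>3 = F\<^sub>n F\<^sub>n\<^sub>+\<^sub>1 - 1\<close>. Their difference is the square of \<open>F\<^sub>n\<^sub>+\<^sub>1\<close>,
  so \<open>x\<^sub>1 = F\<^sub>n\<^sub>+\<^sub>1\<close>, \<open>y\<^sub>1 = F\<^sub>n\<^sub>+\<^sub>2\<close>, \<open>y\<^sub>2 = 1\<close> solve the first two equations. Since \<open>z\<close>
  is increasing, \<open>x\<^sub>2 = z\<^sub>n\<close> is the largest coordinate.
\<close>

lemma fib_even_index_step: "fib (2 * j) + fib (2 * (j + 2)) = 3 * fib (2 * (j + 1))"
  by simp

lemma fib_double_even: "int (fib (4 * m)) =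
    int (fib (2 * m)) * (2 * int (fib (2 * m + 1)) - int (fib (2 * m)))"
proof (cases m)
  case (Suc k)
  have "fib (4 * m) = fib (Suc (2 * m + (2 * k + 1)))"
    by (rule arg_cong[of _ _ fib]) (simp add: Suc)
  also have "\<dots> = fib (Suc (2 * k + 1)) * fib (Suc (2 * m)) + fib (2 * k + 1) * fib (2 * m)"
    by (rule fib_add)
  also have "\<dots> = fib (2 * m) * fib (2 * m + 1) + fib (2 * k + 1) * fib (2 * m)"
    by (simp add: Suc)
  finally have *: "fib (4 * m) = fib (2 * m) * fib (2 * m + 1) + fib (2 * k + 1) * fib (2 * m)" .
  have "fib (2 * m + 1) = fib (2 * m) + fib (2 * k + 1)"
    by (simp add: Suc)
  then show ?thesis
    unfolding * by (simp add: algebra_simps)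
qed simp

lemma fib_double_odd: "fib (4 * m + 1) = fib (2 * m) ^ 2 + fib (2 * m + 1) ^ 2"
  using fib_add[of "2 * m" "2 * m"] by (simp add: power2_eq_square)

lemma fib_Cassini_quadratic:
  "int (fib (2 * m + 1)) ^ 2 = int (fib (2 * m)) ^ 2 + int (fib (2 * m)) * int (fib (2 * m + 1)) + 1"
  using fib_Cassini_int[of "2 * m"] by (simp add: power2_eq_square algebra_simps)

text \<open>As quadratic forms in \<open>F\<^sub>2\<^sub>b\<close> and \<open>F\<^sub>2\<^sub>b\<^sub>+\<^sub>1\<close>, the product on the right exceeds the left-hand
  side by the Cassini form, whose value is 1 at an even index.\<close>

lemma fib_balanced_sum:
  assumes "a = b \<or> a = b + 1"
  shows "int (fib (2 * (a + b))) + 2 * int (fib (2 * a)) * int (fib (2 * b)) =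
    int (fib (a + b + 1)) * int (fib (a + b + 2)) - 1"
  using assms
proof
  assume [simp]: "a = b"
  have 1: "2 * (a + b) = 4 * b" "a + b + 1 = 2 * b + 1" "a + b + 2 = 2 * b + 2" by auto
  have 2: "fib (2 * b + 2) = fib (2 * b) + fib (2 * b + 1)" by simp
  show ?thesis
    unfolding 1 2 fib_double_even using fib_Cassini_quadratic[of b]
    by (simp add: power2_eq_square algebra_simps)
next
  assume [simp]: "a = b + 1"
  have 1: "2 * (a + b) = 4 * b + 2" "a + b + 1 = 2 * b + 2" "a + b + 2 = 2 * b + 3" "2 * a = 2 * b + 2"
    by auto
  have 2: "fib (2 * b + 2) = fib (2 * b) + fib (2 * b + 1)"
    "fib (2 * b + 3) = fib (2 * b) + 2 * fib (2 * b + 1)"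
    by (simp_all add: eval_nat_numeral)
  have "int (fib (4 * b + 2)) = int (fib (4 * b)) + int (fib (4 * b + 1))" by simp
  also have "\<dots> = 2 * int (fib (2 * b)) * int (fib (2 * b + 1)) + int (fib (2 * b + 1)) ^ 2"
    unfolding fib_double_even fib_double_odd by (simp add: power2_eq_square algebra_simps)
  finally show ?thesis
    unfolding 1 2 using fib_Cassini_quadratic[of b]
    by (simp add: power2_eq_square algebra_simps)
qed

text \<open>The sequence \<open>z\<close> with its quotient 5 at \<open>m\<close>. Truncated subtraction makes the second
  term vanish for \<open>j \<le> m\<close>, so that one formula covers both halves.\<close>

definition fib_kink :: "nat \<Rightarrow> nat \<Rightarrow> int" where
  "fib_kink m j = int (fib (2 * j)) + 2 * int (fib (2 * (j - m))) * int (fib (2 * m))"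

text \<open>The sum \<open>z\<^sub>j\<^sub>-\<^sub>1 + z\<^sub>j\<^sub>+\<^sub>1 - 3 z\<^sub>j\<close> vanishes for \<open>j \<noteq> m\<close>, where both terms
  obey the recurrence of the even-indexed Fibonacci numbers; at the kink itself the second term contributes \<open>2 F\<^sub>2 F\<^sub>2\<^sub>m\<close>, that is, \<open>2 z\<^sub>m\<close>.\<close>

lemma fib_kink_step:
  "fib_kink m (j + 1) * (if j + 1 = m then 5 else 3) = fib_kink m j + fib_kink m (j + 2)"
proof -
  have s: "int (fib (2 * (k + 2))) = 3 * int (fib (2 * (k + 1))) - int (fib (2 * k))" for k
    using fib_even_index_step[of k] by linarith
  consider "j + 1 < m" | "j + 1 = m" | "m \<le> j"
    by linarith
  then show ?thesis
  proof cases
    case 1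
    then show ?thesis using s[of j] by (simp add: fib_kink_def)
  next
    case 2
    then have "j - m = 0" "j + 1 - m = 0" "j + 2 - m = 1" by auto
    moreover have "fib (2 * 1) = 1" by (simp add: eval_nat_numeral)
    ultimately show ?thesis using s[of j] unfolding fib_kink_def 2[symmetric] by (simp del: fib.simps(3))
  next
    case 3
    then obtain k where "j = m + k" using le_Suc_ex by blast
    then have "j - m = k" "j + 1 - m = k + 1" "j + 2 - m = k + 2" "j + 1 \<noteq> m" by auto
    then show ?thesis unfolding fib_kink_def s by (simp add: algebra_simps)
  qed
qed

lemma fib_kink_one: "m \<ge> 1 \<Longrightarrow> fib_kink m 1 = 1"
  by (simp add: fib_kink_def eval_nat_numeral)

lemma fib_kink_pos: "j \<ge> 1 \<Longrightarrow> fib_kink m j > 0"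
  unfolding fib_kink_def by (intro add_pos_nonneg) (auto intro: fib_neq_0_nat)

lemma fib_kink_mono:
  assumes "i \<le> j"
  shows "fib_kink m i \<le> fib_kink m j"
proof -
  have "fib (2 * i) \<le> fib (2 * j)" "fib (2 * (i - m)) \<le> fib (2 * (j - m))"
    using assms by (auto intro!: fib_mono)
  then show ?thesis
    unfolding fib_kink_def by (intro add_mono mult_right_mono mult_left_mono) auto
qed

text \<open>The values of \<open>x\<^sub>2\<close> and \<open>x\<^sub>3\<close>. For \<open>x\<^sub>3 = z\<^sub>n\<^sub>-\<^sub>1\<close> the kink stays at \<open>n div 2\<close>, so in terms
  of its own index it sits at half of the successor. Both halves are then still balanced.\<close>

lemma fib_kink_last:
  "fib_kink (n div 2) n = int (fib (n + 1)) * int (fib (n + 2)) - 1"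
proof -
  have "n - n div 2 = n div 2 \<or> n - n div 2 = n div 2 + 1" "n - n div 2 + n div 2 = n"
    by presburger+
  then show ?thesis
    using fib_balanced_sum[of "n - n div 2" "n div 2"] by (simp add: fib_kink_def)
qed

lemma fib_kink_penultimate:
  "fib_kink (Suc n div 2) n = int (fib (n + 1)) * int (fib (n + 2)) - 1"
proof -
  have "n - Suc n div 2 = Suc n div 2 \<or> Suc n div 2 = n - Suc n div 2 + 1"
    "n - Suc n div 2 + Suc n div 2 = n"
    by presburger+
  then show ?thesis
    using fib_balanced_sum[of "n - Suc n div 2" "Suc n div 2"]
      fib_balanced_sum[of "Suc n div 2" "n - Suc n div 2"]
    by (auto simp: fib_kink_def ac_simps)
qed

theorem theorem4p1:
  fixes n :: nat
  assumes "n \<ge> 3"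
  shows "\<exists>(x, y)\<in>Y_B_pos n.
           x 2 = int (fib (n + 1)) * int (fib (n + 2)) - 1 \<and>
           (\<forall>i\<in>{1..n}. x i \<le> x 2 \<and> y i \<le> x 2)"
proof -
  define m where "m = n div 2"
  have m: "m \<ge> 1" using assms by (simp add: m_def)
  define f g where "f = int (fib (n + 1))" and "g = int (fib (n + 2))"
  define x where "x = restrict (\<lambda>i. if i = 1 then f else fib_kink m (n + 2 - i)) {1..n}"
  define y where "y = restrict (\<lambda>i. if i = 1 then g else if i = 2 then 1
      else if n + 2 - i = m then 5 else (3::int)) {1..n}"
  have "fib 4 \<le> fib (n + 1)" "fib 5 \<le> fib (n + 2)"
    using assms by (auto intro!: fib_mono simp del: fib.simps)
  then have fg: "f \<ge> 3" "g \<ge> 5"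
    by (simp_all add: f_def g_def eval_nat_numeral)
  have "int (fib n) + f = g" by (simp add: f_def g_def)
  then have fn: "int (fib n) = g - f" by simp
  have x1: "x 1 = f" and y1: "y 1 = g" and y2: "y 2 = 1"
    and x: "\<And>i. 2 \<le> i \<Longrightarrow> i \<le> n \<Longrightarrow> x i = fib_kink m (n + 2 - i)"
    and y: "\<And>i. 3 \<le> i \<Longrightarrow> i \<le> n \<Longrightarrow> y i = (if n + 2 - i = m then 5 else 3)"
    using assms by (auto simp: x_def y_def)
  have x2: "x 2 = f * g - 1"
    using assms x[of 2] fib_kink_last[of n] by (simp add: m_def f_def g_def)
  have x3: "x 3 = (g - f) * f - 1"
  proof -
    obtain k where n: "n = Suc k" using assms by (cases n) auto
    have "fib_kink (Suc k div 2) k = int (fib n) * f - 1"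
      unfolding fib_kink_penultimate by (simp add: n f_def)
    then show ?thesis
      using assms x[of 3] unfolding fn by (simp add: m_def n)
  qed
  \<comment> \<open>The right-hand side is \<open>x\<^sub>i\<^sub>-\<^sub>1 + x\<^sub>i\<^sub>+\<^sub>1\<close>, written so that it also covers \<open>i = n\<close>, where
    \<open>x\<^sub>n\<^sub>+\<^sub>1\<close> is the value 1 of the sequence at index 1.\<close>
  have step: "x i * y i = fib_kink m (n + 2 - (i - 1)) + fib_kink m (n + 2 - (i + 1))"
    if i: "3 \<le> i" "i \<le> n" for i
  proof -
    obtain j where "n = i + j" using le_Suc_ex[OF i(2)] by blast
    then have "n + 2 - i = (j + 1) + 1" "n + 2 - (i - 1) = (j + 1) + 2" "n + 2 - (i + 1) = j + 1"
      using i by auto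
    then show ?thesis
      using i fib_kink_step[of m "j + 1"] x[of i] y[of i] by simp
  qed
  have "(x, y) \<in> Y_B n"
    unfolding Y_B_def
  proof (clarify, intro conjI ballI)
    show "x \<in> {1..n} \<rightarrow>\<^sub>E UNIV" "y \<in> {1..n} \<rightarrow>\<^sub>E UNIV" by (auto simp: x_def y_def)
    show "x 1 * y 1 = x 2 + 1" unfolding x1 y1 x2 by simp
    show "x 2 * y 2 = (x 1)\<^sup>2 + x 3"
      unfolding x1 y2 x2 x3 by (simp add: power2_eq_square algebra_simps)
    show "x i * y i = x (i - 1) + x (i + 1)" if "i \<in> {3..n - 1}" for i
      using that step[of i] x[of "i - 1"] x[of "i + 1"] by auto
    show "x n * y n = x (n - 1) + 1"
      using assms step[of n] x[of "n - 1"] fib_kink_one[OF m] by simp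
  qed
  moreover have "x i > 0 \<and> y i > 0" if "i \<in> {1..n}" for i
    using that fg by (auto simp: x_def y_def intro!: fib_kink_pos)
  moreover have "x i \<le> x 2 \<and> y i \<le> x 2" if "i \<in> {1..n}" for i
  proof -
    have "f * 5 \<le> f * g" "3 * g \<le> f * g"
      using fg by (auto intro!: mult_left_mono mult_right_mono)
    then have "f \<le> x 2" "g \<le> x 2" "5 \<le> x 2"
      unfolding x2 using fg by linarith+
    moreover have "fib_kink m (n + 2 - i) \<le> x 2" if "i \<noteq> 1"
      using \<open>i \<in> {1..n}\<close> that assms x[of 2] by (auto intro!: fib_kink_mono)
    ultimately show ?thesis
      using that by (auto simp: x_def y_def)
  qed
  ultimately have "(x, y) \<in> Y_B_pos n \<and> x 2 = int (fib (n + 1)) * int (fib (n + 2)) - 1 \<and>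
      (\<forall>i\<in>{1..n}. x i \<le> x 2 \<and> y i \<le> x 2)"
    using x2 unfolding Y_B_pos_def f_def g_def by blast
  then show ?thesis by blast
qed

end
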